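(* Let $n \ge 3$ and let $R$ be a path orientation of $P_n$ (vertices $v_1,\dots,v_n$, edges $e_i=v_iv_{i+1}$). Then $R$ is a $p_2$-orientation if and only if all of the following hold: (a) no two adjacent edges of $R$ are both flat; (b) no flat edge of $R$ is incident with a leaf (i.e. $e_1$ and $e_{n-1}$ are not flat); (c) no flat edge of $R$ is adjacent to two edges that agree (i.e. there is no flat $e_i$ with $e_{i-1},e_{i+1}$ both right edges or both left edges); (d) whenever two adjacent edges $e_j,e_{j+1}$ are directed and agree (both right or both left), both edges $e_{j-1}$ and $e_{j+2}$ exist (i.e. $2\le j$ and $j+2\le n-1$) and each of them is directed and disagrees with $e_j$ (so the five consecutive vertices $v_{j+3},v_{j+2},v_{j+1},v_j,v_{j-1}$ read left to right carry the pattern left, right, right, left or right, left, left, right).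
   Context: Parallel Diffusion on a finite simple graph $G$: a configuration assigns an integer stack size $|v|$ (possibly negative) to each vertex $v$. In one step all vertices fire simultaneously: each vertex sends one chip to each neighbour with strictly smaller stack size, so the new stack size of $v$ is $|v| + \#\{u\sim v: |u|>|v|\} - \#\{u \sim v : |u|<|v|\}$. Starting from $C_0$, $C_{t+1}$ is obtained from $C_t$ by one step. A configuration $D$ is a $p_2$-configuration if there are a configuration $C_0$ and $N$ such that $C_{t+2}=C_t$ and $C_{t+1}\neq C_t$ for all $t\ge N$, and $D=C_t$ for some $t\ge N$ (equivalently, starting from $D$ one has $D_2=D\ne D_1$). The path $P_n$ has vertices $v_1,\dots,v_n$ and edges $e_i=v_iv_{i+1}$ ($1\le i\le n-1$), drawn horizontally with $v_1$ rightmost and $v_n$ leftmost; edges $e_i,e_{i+1}$ are adjacent. A path orientation assigns to each edge either "flat" or a direction. A directed edge $e_i$ is a right edge if directed $v_{i+1}\to v_i$ (head to the right of the tail) and a left edge if directed $v_i\to v_{i+1}$. Two directed edges agree if both are right or both are left, and disagree otherwise. A configuration induces the path orientation in which each edge is directed from the endpoint with larger stack size to the endpoint with smaller stack size, and is flat if the stack sizes are equal. A $p_2$-orientation is a path orientation induced by some $p_2$-configuration. *)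

theory Defs
  imports "HOL-Library.FuncSet"
begin

text \<open>
  A finite simple graph is given by its vertex set \<open>V\<close> and its set \<open>E\<close> of edges, each edge being
  a two-element subset of \<open>V\<close>.
\<close>

definition simple_graph :: "'a set \<Rightarrow> 'a set set \<Rightarrow> bool" where
  "simple_graph V E \<longleftrightarrow> finite V \<and> (\<forall>e\<in>E. e \<subseteq> V \<and> card e = 2)"

text \<open>
  Configurations are extensional functions (\<open>undefined\<close> outside \<open>V\<close>), so that equality of
  configurations is equality of all stack sizes on \<open>V\<close>.
\<close>

definition configurations :: "'a set \<Rightarrow> ('a \<Rightarrow> int) set" where
  "configurations V = V \<rightarrow>\<^sub>E UNIV"

definition diffusion_step :: "'a set \<Rightarrow> 'a set set \<Rightarrow> ('a \<Rightarrow> int) \<Rightarrow> ('a \<Rightarrow> int)" where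
  "diffusion_step V E C =
     (\<lambda>v\<in>V. C v + int (card {u\<in>V. {u, v} \<in> E \<and> C u > C v})
               - int (card {u\<in>V. {u, v} \<in> E \<and> C u < C v}))"

definition diffusion :: "'a set \<Rightarrow> 'a set set \<Rightarrow> ('a \<Rightarrow> int) \<Rightarrow> nat \<Rightarrow> ('a \<Rightarrow> int)" where
  "diffusion V E C t = (diffusion_step V E ^^ t) C"

definition p2_configuration :: "'a set \<Rightarrow> 'a set set \<Rightarrow> ('a \<Rightarrow> int) \<Rightarrow> bool" where
  "p2_configuration V E D \<longleftrightarrow>
     (\<exists>C\<in>configurations V. \<exists>N.
        (\<forall>t\<ge>N. diffusion V E C (t + 2) = diffusion V E C t \<and>
                diffusion V E C (t + 1) \<noteq> diffusion V E C t) \<and>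
        (\<exists>t\<ge>N. D = diffusion V E C t))"

text \<open>
  The path on \<open>n\<close> vertices: \<open>v\<^sub>i\<close> is represented by \<open>i \<in> {1..n}\<close> and the edge \<open>e\<^sub>i = v\<^sub>i v\<^sub>i\<^sub>+\<^sub>1\<close>
  by its index \<open>i \<in> {1..n - 1}\<close>.
\<close>

definition path_vertices :: "nat \<Rightarrow> nat set" where
  "path_vertices n = {1..n}"

definition path_edges :: "nat \<Rightarrow> nat set set" where
  "path_edges n = (\<lambda>i. {i, i + 1}) ` {1..n - 1}"

lemma simple_graph_path: "simple_graph (path_vertices n) (path_edges n)"
  by (auto simp: simple_graph_def path_vertices_def path_edges_def)

text \<open>
  The path is drawn with \<open>v\<^sub>1\<close> rightmost. Hence on the edge \<open>e\<^sub>i\<close>, \<open>Right\<close> is the direction from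
  \<open>v\<^sub>i\<^sub>+\<^sub>1\<close> to \<open>v\<^sub>i\<close>, and \<open>Left\<close> is the direction from \<open>v\<^sub>i\<close> to \<open>v\<^sub>i\<^sub>+\<^sub>1\<close>.
\<close>

datatype edge_orientation = Flat | Right | Left

definition path_orientations :: "nat \<Rightarrow> (nat \<Rightarrow> edge_orientation) set" where
  "path_orientations n = {1..n - 1} \<rightarrow>\<^sub>E UNIV"

definition directed :: "edge_orientation \<Rightarrow> bool" where
  "directed a \<longleftrightarrow> a = Right \<or> a = Left"

definition agree :: "edge_orientation \<Rightarrow> edge_orientation \<Rightarrow> bool" where
  "agree a b \<longleftrightarrow> (a = Right \<and> b = Right) \<or> (a = Left \<and> b = Left)"

definition disagree :: "edge_orientation \<Rightarrow> edge_orientation \<Rightarrow> bool" where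
  "disagree a b \<longleftrightarrow> directed a \<and> directed b \<and> \<not> agree a b"

definition induced_orientation :: "nat \<Rightarrow> (nat \<Rightarrow> int) \<Rightarrow> (nat \<Rightarrow> edge_orientation)" where
  "induced_orientation n C =
     (\<lambda>i\<in>{1..n - 1}. if C (i + 1) > C i then Right else if C (i + 1) < C i then Left else Flat)"

definition p2_orientation :: "nat \<Rightarrow> (nat \<Rightarrow> edge_orientation) \<Rightarrow> bool" where
  "p2_orientation n R \<longleftrightarrow>
     (\<exists>D. p2_configuration (path_vertices n) (path_edges n) D \<and> R = induced_orientation n D)"

end

theory Submission
  imports Defs
begin

text \<open>
  Encode an orientation by the signs \<open>s\<^sub>i \<in> {1, 0, -1}\<close> of the increments \<open>d\<^sub>i = |v\<^sub>i\<^sub>+\<^sub>1| - |v\<^sub>i|\<close>, with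
  \<open>s\<^sub>0 = s\<^sub>n = 0\<close>. One step changes \<open>|v\<^sub>i|\<close> by \<open>s\<^sub>i - s\<^sub>i\<^sub>-\<^sub>1\<close>, so two steps restore the configuration
  iff every sign is reversed by one step. As \<open>d\<^sub>i\<close> becomes \<open>d\<^sub>i + s\<^sub>i\<^sub>-\<^sub>1 + s\<^sub>i\<^sub>+\<^sub>1 - 2s\<^sub>i\<close>, a reversal at
  \<open>i\<close> is possible for some \<open>d\<^sub>i\<close> of sign \<open>s\<^sub>i\<close> iff it is possible for the smallest one, \<open>d\<^sub>i = s\<^sub>i\<close>,
  that is, iff \<open>sgn (s\<^sub>i\<^sub>-\<^sub>1 + s\<^sub>i\<^sub>+\<^sub>1 - s\<^sub>i) = - s\<^sub>i\<close>. The increments of a configuration on a path are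
  arbitrary, so this local condition, for a nonzero sign sequence, characterises the
  \<open>p\<^sub>2\<close>-orientations. In it, two adjacent zeros (or a zero next to \<open>s\<^sub>0\<close> or \<open>s\<^sub>n\<close>) would propagate
  along the whole path; the rest is a finite case distinction.
\<close>

section \<open>Sign encoding of orientations\<close>

definition signs :: "nat \<Rightarrow> (nat \<Rightarrow> edge_orientation) \<Rightarrow> nat \<Rightarrow> int" where
  "signs n R i =
     (if i \<in> {1..n - 1} then (case R i of Flat \<Rightarrow> 0 | Right \<Rightarrow> 1 | Left \<Rightarrow> - 1) else 0)"

abbreviation config_signs :: "nat \<Rightarrow> (nat \<Rightarrow> int) \<Rightarrow> nat \<Rightarrow> int" where
  "config_signs n C \<equiv> signs n (induced_orientation n C)"

abbreviation path_step :: "nat \<Rightarrow> (nat \<Rightarrow> int) \<Rightarrow> nat \<Rightarrow> int" where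
  "path_step n \<equiv> diffusion_step (path_vertices n) (path_edges n)"

lemma signs_outside [simp]: "i \<notin> {1..n - 1} \<Longrightarrow> signs n R i = 0"
  by (simp only: signs_def if_False)

lemma signs_eq_iff:
  assumes "i \<in> {1..n - 1}"
  shows "signs n R i = 0 \<longleftrightarrow> R i = Flat"
    and "signs n R i = 1 \<longleftrightarrow> R i = Right"
    and "signs n R i = - 1 \<longleftrightarrow> R i = Left"
  using assms by (auto simp: signs_def split: edge_orientation.splits)

lemma signs_cases: "signs n R i = 0 \<or> signs n R i = 1 \<or> signs n R i = - 1"
  by (auto simp: signs_def split: edge_orientation.splits)

lemma sgn_signs [simp]: "sgn (signs n R i) = signs n R i"
  using signs_cases[of n R i] by auto

lemma config_signs:
  "i \<in> {1..n - 1} \<Longrightarrow> config_signs n C i = sgn (C (i + 1) - C i)"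
  by (auto simp: signs_def induced_orientation_def sgn_if)

lemma induced_orientation_eqI:
  assumes "R \<in> path_orientations n" and "\<And>i. i \<in> {1..n - 1} \<Longrightarrow> config_signs n C i = signs n R i"
  shows "R = induced_orientation n C"
proof
  fix i
  show "R i = induced_orientation n C i"
  proof (cases "i \<in> {1..n - 1}")
    case True
    with assms(2)[OF True] show ?thesis
      by (simp add: signs_def split: edge_orientation.splits)
  next
    case False
    with assms(1) show ?thesis
      by (auto simp: path_orientations_def induced_orientation_def PiE_def extensional_def)
  qed
qed

section \<open>One diffusion step on the path\<close>

lemma path_edges_iff:
  "{u, v} \<in> path_edges n \<longleftrightarrow> (v = u + 1 \<and> u \<in> {1..n - 1} \<or> u = v + 1 \<and> v \<in> {1..n - 1})"
  by (auto simp: path_edges_def doubleton_eq_iff)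

lemma card_path_neighbours:
  assumes "v \<in> {1..n}"
  shows "int (card {u \<in> path_vertices n. {u, v} \<in> path_edges n \<and> P u}) =
    of_bool (v \<in> {1..n - 1} \<and> P (v + 1)) + of_bool (v - 1 \<in> {1..n - 1} \<and> P (v - 1))"
proof -
  have "{u \<in> path_vertices n. {u, v} \<in> path_edges n \<and> P u} =
      (if v \<in> {1..n - 1} \<and> P (v + 1) then {v + 1} else {}) \<union>
      (if v - 1 \<in> {1..n - 1} \<and> P (v - 1) then {v - 1} else {})"
    using assms by (auto simp: path_edges_iff path_vertices_def)
  then show ?thesis
    by simp
qed

text \<open>The leaves need no separate case: for \<open>v = 1\<close> and \<open>v = n\<close> the
  sign of the missing edge has index \<open>0\<close> or \<open>n\<close>, where
  \<open>signs\<close> vanishes.\<close>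

lemma path_step:
  assumes "v \<in> {1..n}"
  shows "path_step n C v = C v + config_signs n C v - config_signs n C (v - 1)"
proof -
  have "config_signs n C v = of_bool (v \<in> {1..n - 1} \<and> C (v + 1) > C v) -
      of_bool (v \<in> {1..n - 1} \<and> C (v + 1) < C v)"
    using config_signs[of v n C] by (cases "v \<in> {1..n - 1}") (auto simp: sgn_if)
  moreover have "config_signs n C (v - 1) = of_bool (v - 1 \<in> {1..n - 1} \<and> C (v - 1) < C v) -
      of_bool (v - 1 \<in> {1..n - 1} \<and> C (v - 1) > C v)"
    using config_signs[of "v - 1" n C] assms
    by (cases "v - 1 \<in> {1..n - 1}") (auto simp: sgn_if)
  moreover have "path_step n C v =
      C v + int (card {u \<in> path_vertices n. {u, v} \<in> path_edges n \<and> C u > C v})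
        - int (card {u \<in> path_vertices n. {u, v} \<in> path_edges n \<and> C u < C v})"
    using assms by (simp add: diffusion_step_def path_vertices_def)
  ultimately show ?thesis
    unfolding card_path_neighbours[OF assms] by simp
qed

lemma path_step_extensional: "path_step n C \<in> extensional {1..n}"
  by (simp add: diffusion_step_def path_vertices_def)

text \<open>A vertex keeps its stack size iff the signs on its two sides are equal, so the value 0
  at index 0 is passed along the path.\<close>

lemma path_step_fixed_iff:
  assumes "C \<in> extensional {1..n}"
  shows "path_step n C = C \<longleftrightarrow> (\<forall>i\<in>{1..n - 1}. config_signs n C i = 0)"
proof
  assume fixed: "path_step n C = C"
  have "config_signs n C i = 0" if "i \<le> n - 1" for i
    using that
  proof (induction i)
    case (Suc i)
    with path_step[of "Suc i" n C] fixed show ?case by simp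
  qed simp
  then show "\<forall>i\<in>{1..n - 1}. config_signs n C i = 0" by simp
next
  assume "\<forall>i\<in>{1..n - 1}. config_signs n C i = 0"
  then have "config_signs n C i = 0" for i
    by (cases "i \<in> {1..n - 1}") auto
  then show "path_step n C = C"
    using assms by (intro extensionalityI[OF path_step_extensional]) (simp_all add: path_step)
qed

text \<open>Let \<open>s\<close> and \<open>s'\<close> be the signs before and after the first step.
  Two steps restore vertex \<open>i\<close> iff \<open>s + s'\<close> takes the same value at
  \<open>i - 1\<close> and \<open>i\<close>; at index 0 this value is 0.\<close>

lemma path_step_period2_iff:
  assumes "C \<in> extensional {1..n}"
  shows "path_step n (path_step n C) = C \<longleftrightarrow>
    (\<forall>i\<in>{1..n - 1}. config_signs n (path_step n C) i = - config_signs n C i)"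
proof
  assume period: "path_step n (path_step n C) = C"
  have "config_signs n (path_step n C) i = - config_signs n C i" if "i \<le> n - 1" for i
    using that
  proof (induction i)
    case (Suc i)
    then have "Suc i \<in> {1..n}" by simp
    from path_step[OF this, of C] path_step[OF this, of "path_step n C"] Suc fun_cong[OF period]
    show ?case by (simp only: diff_Suc_1)
  qed simp
  then show "\<forall>i\<in>{1..n - 1}. config_signs n (path_step n C) i = - config_signs n C i" by simp
next
  assume "\<forall>i\<in>{1..n - 1}. config_signs n (path_step n C) i = - config_signs n C i"
  then have "config_signs n (path_step n C) i = - config_signs n C i" for i
    by (cases "i \<in> {1..n - 1}") auto
  then show "path_step n (path_step n C) = C"
    using assms by (intro extensionalityI[OF path_step_extensional]) (simp_all add: path_step)
qed

lemma config_signs_path_step: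
  assumes "i \<in> {1..n - 1}"
  shows "config_signs n (path_step n C) i =
    sgn (C (i + 1) - C i + config_signs n C (i - 1) + config_signs n C (i + 1)
      - 2 * config_signs n C i)"
proof -
  from assms have "path_step n C (i + 1) - path_step n C i =
      C (i + 1) - C i + config_signs n C (i - 1) + config_signs n C (i + 1)
      - 2 * config_signs n C i"
    by (subst (1 2) path_step) auto
  with assms show ?thesis
    by (simp add: config_signs del: atLeastAtMost_iff)
qed

section \<open>From periodic orbits to a local sign condition\<close>

lemma diffusion_Suc: "diffusion V E C (Suc t) = diffusion_step V E (diffusion V E C t)"
  by (simp add: diffusion_def)

text \<open>A configuration of period exactly 2 can serve as its own starting point with
  \<open>N = 0\<close>, which removes the transient phase from the definition.\<close>

lemma p2_configuration_path_iff:
  "p2_configuration (path_vertices n) (path_edges n) D \<longleftrightarrow>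
    D \<in> extensional {1..n} \<and> path_step n (path_step n D) = D \<and> path_step n D \<noteq> D"
  (is "?p2 \<longleftrightarrow> ?ext \<and> ?period \<and> ?moves")
proof
  assume ?p2
  then have *: "?period \<and> ?moves"
    by (auto simp: p2_configuration_def diffusion_Suc)
  with path_step_extensional[of n "path_step n D"] show "?ext \<and> ?period \<and> ?moves"
    by simp
next
  assume *: "?ext \<and> ?period \<and> ?moves"
  have "diffusion (path_vertices n) (path_edges n) D t \<in> {D, path_step n D}" for t
    using * by (induction t) (auto simp: diffusion_def)
  with * have "diffusion (path_vertices n) (path_edges n) D (t + 2) =
        diffusion (path_vertices n) (path_edges n) D t \<and>
      diffusion (path_vertices n) (path_edges n) D (t + 1) \<noteq>
        diffusion (path_vertices n) (path_edges n) D t" for t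
    by (simp add: diffusion_Suc) metis
  moreover have "D = diffusion (path_vertices n) (path_edges n) D 0"
    by (simp add: diffusion_def)
  moreover have "D \<in> configurations (path_vertices n)"
    using * by (simp add: configurations_def path_vertices_def PiE_def)
  ultimately show ?p2
    unfolding p2_configuration_def by blast
qed

text \<open>Here \<open>d\<close> is an increment and \<open>r\<close> the sum of the neighbouring
  signs. If \<open>d > 0\<close>, then \<open>d + r < 2\<close> and \<open>d \<ge> 1\<close> give
  \<open>r < 1\<close>; the case \<open>d < 0\<close> is symmetric.\<close>

lemma sgn_reversal_minimal:
  fixes d r :: int
  assumes "sgn (d + r - 2 * sgn d) = - sgn d"
  shows "sgn (r - sgn d) = - sgn d"
  using assms by (cases d "0 :: int" rule: linorder_cases) (auto simp: sgn_if split: if_splits)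

lemma p2_orientation_iff_signs:
  assumes "R \<in> path_orientations n"
  shows "p2_orientation n R \<longleftrightarrow>
    (\<exists>i\<in>{1..n - 1}. signs n R i \<noteq> 0) \<and>
    (\<forall>i\<in>{1..n - 1}. sgn (signs n R (i - 1) + signs n R (i + 1) - signs n R i) = - signs n R i)"
    (is "_ \<longleftrightarrow> ?nonzero \<and> ?local")
proof
  assume "p2_orientation n R"
  then obtain D where D: "D \<in> extensional {1..n}" "path_step n (path_step n D) = D"
      "path_step n D \<noteq> D" and R: "R = induced_orientation n D"
    by (auto simp: p2_orientation_def p2_configuration_path_iff)
  have ?nonzero
    using D path_step_fixed_iff R by blast
  moreover have ?local
  proof
    fix i assume i: "i \<in> {1..n - 1}"
    then have "sgn (D (i + 1) - D i + signs n R (i - 1) + signs n R (i + 1) - 2 * signs n R i)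
        = - signs n R i"
      using D path_step_period2_iff config_signs_path_step[OF i, of D] R by metis
    moreover have "signs n R i = sgn (D (i + 1) - D i)"
      using config_signs[OF i] R by simp
    ultimately show "sgn (signs n R (i - 1) + signs n R (i + 1) - signs n R i) = - signs n R i"
      using sgn_reversal_minimal[of "D (i + 1) - D i" "signs n R (i - 1) + signs n R (i + 1)"]
      by (simp add: add.assoc)
  qed
  ultimately show "?nonzero \<and> ?local" ..
next
  assume *: "?nonzero \<and> ?local"
  \<comment> \<open>Partial sums realise the signs themselves as increments, the smallest ones
    possible; the term at index 0 is zero.\<close>
  define D where "D = (\<lambda>v\<in>{1..n}. \<Sum>i<v. signs n R i)"
  have D_diff: "D (i + 1) - D i = signs n R i" if "i \<in> {1..n - 1}" for i
    using that by (auto simp: D_def)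
  then have "config_signs n D i = signs n R i" if "i \<in> {1..n - 1}" for i
    using that by (simp add: config_signs del: atLeastAtMost_iff)
  with assms have R: "R = induced_orientation n D"
    by (rule induced_orientation_eqI)
  have ext: "D \<in> extensional {1..n}"
    by (simp add: D_def)
  have "config_signs n (path_step n D) i = - config_signs n D i" if "i \<in> {1..n - 1}" for i
    using * that config_signs_path_step[OF that, of D] D_diff[OF that]
    unfolding R[symmetric] by (simp add: algebra_simps del: atLeastAtMost_iff)
  then have "path_step n (path_step n D) = D"
    using ext path_step_period2_iff by blast
  moreover have "path_step n D \<noteq> D"
    using * ext path_step_fixed_iff R by blast
  ultimately show "p2_orientation n R"
    using R ext by (auto simp: p2_orientation_def p2_configuration_path_iff)
qed

section \<open>The local sign condition against the conditions on edges\<close>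

text \<open>Where \<open>s i = 0\<close>, the condition says that the two neighbouring values sum to
  0, so a pair of zeros spreads in both directions. The range of \<open>j\<close> includes
  \<open>0\<close> and \<open>m\<close>, which covers the pairs at the ends.\<close>

lemma no_consecutive_zeros:
  fixes s :: "nat \<Rightarrow> int"
  assumes local: "\<And>i. i \<in> {1..m} \<Longrightarrow> sgn (s (i - 1) + s (i + 1) - s i) = - s i"
    and nonzero: "\<exists>i\<in>{1..m}. s i \<noteq> 0"
    and "j \<le> m"
  shows "\<not> (s j = 0 \<and> s (j + 1) = 0)"
proof
  assume zeros: "s j = 0 \<and> s (j + 1) = 0"
  have up: "s i = 0 \<and> s (i + 1) = 0" if "j \<le> i" "i \<le> m" for i
    using that
  proof (induction rule: dec_induct)
    case (step i)
    with local[of "Suc i"] show ?case by (simp add: sgn_0_0)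
  qed (use zeros in simp)
  have down: "s i = 0 \<and> s (i + 1) = 0" if "i \<le> j" for i
    using that
  proof (induction rule: inc_induct)
    case (step i)
    with local[of "Suc i"] \<open>j \<le> m\<close> show ?case by (simp add: sgn_0_0)
  qed (use zeros in simp)
  from up down nonzero show False
    by (metis atLeastAtMost_iff nat_le_linear)
qed

text \<open>For sign 1 the left side says that the neighbouring signs have sum at most 0: if one of
  them is 1, the other must be -1. Sign -1 is symmetric.\<close>

lemma signs_local_iff:
  assumes "i \<in> {1..n - 1}" and "signs n R i \<noteq> 0"
  shows "sgn (signs n R (i - 1) + signs n R (i + 1) - signs n R i) = - signs n R i \<longleftrightarrow>
    (signs n R (i - 1) = signs n R i \<longrightarrow> signs n R (i + 1) = - signs n R i) \<and>
    (signs n R (i + 1) = signs n R i \<longrightarrow> signs n R (i - 1) = - signs n R i)"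
  using assms(2) signs_cases[of n R i] signs_cases[of n R "i - 1"] signs_cases[of n R "i + 1"]
  by (elim disjE) simp_all

lemma agree_iff_signs:
  assumes "i \<in> {1..n - 1}" and "j \<in> {1..n - 1}"
  shows "agree (R i) (R j) \<longleftrightarrow> signs n R i = signs n R j \<and> signs n R i \<noteq> 0"
  using assms by (auto simp: signs_def agree_def split: edge_orientation.splits)

lemma disagree_iff_signs:
  assumes "i \<in> {1..n - 1}" and "j \<in> {1..n - 1}"
  shows "disagree (R i) (R j) \<longleftrightarrow> signs n R i = - signs n R j \<and> signs n R i \<noteq> 0"
  using assms
  by (auto simp: signs_def agree_def directed_def disagree_def split: edge_orientation.splits)

theorem theorem2:
  fixes n :: nat and R :: "nat \<Rightarrow> edge_orientation"
  assumes "n \<ge> 3" and "R \<in> path_orientations n"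
  shows "p2_orientation n R \<longleftrightarrow>
      (\<forall>i. 1 \<le> i \<and> i + 1 \<le> n - 1 \<longrightarrow> \<not> (R i = Flat \<and> R (i + 1) = Flat))
    \<and> (R 1 \<noteq> Flat \<and> R (n - 1) \<noteq> Flat)
    \<and> (\<forall>i. 2 \<le> i \<and> i + 1 \<le> n - 1 \<and> R i = Flat \<longrightarrow> \<not> agree (R (i - 1)) (R (i + 1)))
    \<and> (\<forall>j. 1 \<le> j \<and> j + 1 \<le> n - 1 \<and> agree (R j) (R (j + 1)) \<longrightarrow>
          2 \<le> j \<and> j + 2 \<le> n - 1 \<and>
          disagree (R (j - 1)) (R j) \<and> disagree (R (j + 2)) (R j))"
    (is "_ \<longleftrightarrow> ?a \<and> ?b \<and> ?c \<and> ?d")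
proof -
  let ?s = "signs n R"
  let ?I = "{1..n - 1}"
  note flat = signs_eq_iff(1)[where n = n and R = R, symmetric]
  show ?thesis
    unfolding p2_orientation_iff_signs[OF assms(2)]
  proof (intro iffI)
    assume "(\<exists>i\<in>?I. ?s i \<noteq> 0) \<and> (\<forall>i\<in>?I. sgn (?s (i - 1) + ?s (i + 1) - ?s i) = - ?s i)"
    then have nonzero: "\<exists>i\<in>?I. ?s i \<noteq> 0"
      and local: "\<And>i. i \<in> ?I \<Longrightarrow> sgn (?s (i - 1) + ?s (i + 1) - ?s i) = - ?s i"
      by blast+
    note zeros = no_consecutive_zeros[of "n - 1" ?s, OF local nonzero]
    have ?a
    proof (intro allI impI)
      fix i assume "1 \<le> i \<and> i + 1 \<le> n - 1"
      then show "\<not> (R i = Flat \<and> R (i + 1) = Flat)"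
        using zeros[of i] by (simp add: flat)
    qed
    moreover have ?b
      \<comment> \<open>A flat end edge would form a pair of zeros with the conventional zero at
        index \<open>0\<close> or \<open>n\<close>.\<close>
      using zeros[of 0] zeros[of "n - 1"] assms(1) by (auto simp: flat)
    moreover have ?c
    proof (intro allI impI, elim conjE)
      fix i assume i: "2 \<le> i" "i + 1 \<le> n - 1" "R i = Flat"
      then have "?s (i - 1) + ?s (i + 1) = 0"
        using local[of i] by (simp add: flat sgn_0_0)
      with i show "\<not> agree (R (i - 1)) (R (i + 1))"
        by (subst agree_iff_signs[where n = n]) auto
    qed
    moreover have ?d
    proof (intro allI impI, elim conjE)
      fix j assume j: "1 \<le> j" "j + 1 \<le> n - 1" "agree (R j) (R (j + 1))"
      then have I: "j \<in> ?I" "j + 1 \<in> ?I"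
        by simp_all
      then have eq: "?s (j + 1) = ?s j" "?s j \<noteq> 0" "?s (j + 1) \<noteq> 0"
        using j(3) agree_iff_signs[OF I, of R] by simp_all
      then have opp: "?s (j - 1) = - ?s j" "?s (j + 2) = - ?s j"
        using local[OF I(1), unfolded signs_local_iff[OF I(1) eq(2)]]
          local[OF I(2), unfolded signs_local_iff[OF I(2) eq(3)]] by simp_all
      with eq have "?s (j - 1) \<noteq> 0" "?s (j + 2) \<noteq> 0"
        by auto
      \<comment> \<open>A nonzero sign certifies that the edge exists, since \<open>signs\<close> is
        0 outside \<open>?I\<close>.\<close>
      then have "j - 1 \<in> ?I" "j + 2 \<in> ?I"
        using signs_outside by blast+
      with opp eq j show "2 \<le> j \<and> j + 2 \<le> n - 1 \<and>
          disagree (R (j - 1)) (R j) \<and> disagree (R (j + 2)) (R j)"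
        by (auto simp: disagree_iff_signs[where n = n])
    qed
    ultimately show "?a \<and> ?b \<and> ?c \<and> ?d"
      by blast
  next
    assume "?a \<and> ?b \<and> ?c \<and> ?d"
    then have a: ?a and b: ?b and c: ?c and d: ?d
      by blast+
    have "?s 1 \<noteq> 0"
      using b assms(1) by (simp add: signs_eq_iff)
    moreover have "sgn (?s (i - 1) + ?s (i + 1) - ?s i) = - ?s i" if i: "i \<in> ?I" for i
    proof (cases "?s i = 0")
      case True
      then have Flat: "R i = Flat"
        using i by (simp add: flat)
      with b have "i \<noteq> 1" "i \<noteq> n - 1"
        by metis+
      with i have range: "2 \<le> i" "i + 1 \<le> n - 1" "i - 1 \<in> ?I" "i + 1 \<in> ?I"
        by auto
      \<comment> \<open>By \<open>a\<close> both neighbours of a flat edge are directed, and by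
        \<open>c\<close> they do not agree, so their signs cancel.\<close>
      have "R (i + 1) \<noteq> Flat" "R (i - 1) \<noteq> Flat"
        using Flat i range a[rule_format, of i] a[rule_format, of "i - 1"] by auto
      then have "?s (i + 1) \<noteq> 0" "?s (i - 1) \<noteq> 0"
        using range by (auto simp: flat)
      moreover have "\<not> agree (R (i - 1)) (R (i + 1))"
        using c Flat range by blast
      then have "?s (i - 1) \<noteq> ?s (i + 1)"
        using calculation agree_iff_signs[OF range(3,4)] by simp
      ultimately have "?s (i - 1) + ?s (i + 1) = 0"
        using signs_cases[of n R "i - 1"] signs_cases[of n R "i + 1"] by auto
      with True show ?thesis by simp
    next
      case False
      have "?s (i + 1) = - ?s i" if eq: "?s (i - 1) = ?s i"
      proof -
        have I: "i - 1 \<in> ?I"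
          using eq False signs_outside by metis
        \<comment> \<open>Condition \<open>d\<close> is applied at \<open>j = i - 1\<close>, so its
          edge \<open>j + 2\<close> is \<open>i + 1\<close>; natural subtraction is exact because
          \<open>I\<close> gives \<open>i - 1 \<ge> 1\<close>.\<close>
        then have shift: "i - 1 + 1 = i" "i - 1 + 2 = i + 1"
          by auto
        have "agree (R (i - 1)) (R i)"
          using eq False agree_iff_signs[OF I i] by simp
        then have opp: "i + 1 \<in> ?I" "disagree (R (i + 1)) (R (i - 1))"
          using d[rule_format, of "i - 1"] I i unfolding shift by auto
        then show ?thesis
          using disagree_iff_signs[OF opp(1) I] eq by simp
      qed
      moreover have "?s (i - 1) = - ?s i" if eq: "?s (i + 1) = ?s i"
      proof -
        have I: "i + 1 \<in> ?I"
          using eq False signs_outside by metis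
        have "agree (R i) (R (i + 1))"
          using eq False agree_iff_signs[OF i I] by simp
        then have opp: "i - 1 \<in> ?I" "disagree (R (i - 1)) (R i)"
          using d[rule_format, of i] I i by auto
        then show ?thesis
          using disagree_iff_signs[OF opp(1) i] by simp
      qed
      ultimately show ?thesis
        using signs_local_iff[OF i False] by blast
    qed
    ultimately show "(\<exists>i\<in>?I. ?s i \<noteq> 0) \<and>
        (\<forall>i\<in>?I. sgn (?s (i - 1) + ?s (i + 1) - ?s i) = - ?s i)"
      using assms(1) by (intro conjI bexI[of _ 1]) auto
  qed
qed

end
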